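(* Let $\mathbf n=(n_0,n_1,\ldots)$ be a sequence of (positive) natural numbers, and assume $\lim_{k\to\infty}(n_{k+1}/n_k)=\infty$. Then the set $$\{\alpha\in\mathbb R/\mathbb Z:\ \mathbf n\alpha\text{ is maldistributed}\}$$ is residual in $\mathbb R/\mathbb Z$.
   Context: For $\mathbf n=(n_k)$ and $\alpha\in\mathbb R/\mathbb Z$, $\mathbf n\alpha$ denotes the sequence $(n_k\alpha)_k$ in $X=\mathbb R/\mathbb Z$. $\mathcal M(X)$ is the set of Borel probability measures on $X$ with the topology of weak convergence. For a sequence $\mathbf x=(x_n)$ in $X$ let $\mu_{\mathbf x,N}=\frac1N\sum_n\delta_{x_n}$, the sum being over the first $N$ terms of the sequence, and let $M(\mathbf x)\subseteq\mathcal M(X)$ be the set of accumulation points $\bigcap_{N_0\ge1}\overline{\{\mu_{\mathbf x,N}: N\ge N_0\}}$ of the sequence $(\mu_{\mathbf x,N})_N$. The sequence $\mathbf x$ is called maldistributed if $M(\mathbf x)=\mathcal M(X)$. A set is residual if its complement is meager (of first Baire category). *)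

theory Defs
  imports "HOL-Probability.Probability"
begin

quotient_type circle = real / "\<lambda>x y. x - y \<in> \<int>"
  morphisms rep_circle to_circle
proof (rule equivpI)
  show "reflp (\<lambda>x y::real. x - y \<in> \<int>)"
    by (simp add: reflp_def)
  show "symp (\<lambda>x y::real. x - y \<in> \<int>)"
    by (metis (no_types, lifting) Ints_minus minus_diff_eq sympI)
  show "transp (\<lambda>x y::real. x - y \<in> \<int>)"
  proof (rule transpI)
    fix x y z :: real
    assume "x - y \<in> \<int>" "y - z \<in> \<int>"
    then have "(x - y) + (y - z) \<in> \<int>" by (rule Ints_add)
    then show "x - z \<in> \<int>" by simp
  qed
qed

instantiation circle :: ab_group_add
begin

lift_definition zero_circle :: circle is "0 :: real" .

lift_definition plus_circle :: "circle \<Rightarrow> circle \<Rightarrow> circle" is "(+)"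
  by (metis (no_types, lifting) Ints_add add_diff_add)

lift_definition uminus_circle :: "circle \<Rightarrow> circle" is "uminus"
  by (metis (no_types, lifting) Ints_minus minus_diff_minus)

lift_definition minus_circle :: "circle \<Rightarrow> circle \<Rightarrow> circle" is "(-)"
  by (metis (no_types, opaque_lifting) Ints_diff diff_diff_eq diff_diff_eq2 add_diff_eq diff_add_eq add.commute)

instance
  by standard (transfer, simp)+

end

instantiation circle :: topological_space
begin

text \<open>\<open>to_circle\<close> is the projection \<open>\<real> \<rightarrow> \<real>/\<int>\<close>, so this is the quotient topology.\<close>

definition open_circle :: "circle set \<Rightarrow> bool" where
  "open_circle U \<longleftrightarrow> open (to_circle -` U)"

instance
  by standard (auto simp: open_circle_def vimage_Union)

end

lift_definition circle_mult :: "nat \<Rightarrow> circle \<Rightarrow> circle" is "\<lambda>m x. real m * x"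
  by (metis Ints_mult Ints_of_nat right_diff_distrib)

lemma circle_mult_eq_sum: "circle_mult m \<alpha> = (\<Sum>i<m. \<alpha>)"
proof (induction m)
  case 0
  show ?case unfolding lessThan_0 sum.empty by transfer simp
next
  case (Suc m)
  have "circle_mult (Suc m) \<alpha> = circle_mult m \<alpha> + \<alpha>"
    by transfer (simp add: algebra_simps)
  with Suc show ?case by simp
qed

abbreviation borel_prob_measures :: "'a::topological_space measure set" where
  "borel_prob_measures \<equiv> space (prob_algebra borel)"

text \<open>The topology of weak convergence: the coarsest topology on the Borel probability measures
  making \<open>\<mu> \<mapsto> \<integral> f d\<mu>\<close> continuous for every bounded continuous real function \<open>f\<close>.\<close>

definition weak_topology :: "'a::topological_space measure topology" where
  "weak_topology = topology_generated_by
     {{\<mu> \<in> borel_prob_measures. integral\<^sup>L \<mu> f \<in> U} | f U.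
        continuous_on UNIV f \<and> bounded (range f) \<and> open (U :: real set)}"

lemma topspace_weak_topology: "topspace weak_topology = borel_prob_measures"
proof -
  have "borel_prob_measures \<in> {{\<mu> \<in> borel_prob_measures. integral\<^sup>L \<mu> f \<in> U} | f U.
        continuous_on UNIV f \<and> bounded (range (f :: 'a \<Rightarrow> real)) \<and> open (U :: real set)}"
    by (intro CollectI exI[of _ "\<lambda>_. 0"] exI[of _ UNIV]) auto
  then show ?thesis
    unfolding weak_topology_def topology_generated_by_topspace by blast
qed

text \<open>The average of the Dirac measures at the first \<open>N\<close> terms; it is a probability measure
  only for \<open>N \<ge> 1\<close>, hence the range of \<open>N\<^sub>0\<close> in \<open>empirical_limits\<close>.\<close>

definition empirical_measure :: "(nat \<Rightarrow> 'a::topological_space) \<Rightarrow> nat \<Rightarrow> 'a measure" where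
  "empirical_measure x N =
     measure_of UNIV (sets borel) (\<lambda>A. (\<Sum>n<N. emeasure (return borel (x n)) A) / of_nat N)"

lemma sets_empirical_measure: "sets (empirical_measure x N) = sets borel"
  unfolding empirical_measure_def by (metis sets.sets_measure_of_eq space_borel)

lemma emeasure_empirical_measure:
  assumes "A \<in> sets borel"
  shows "emeasure (empirical_measure x N) A
         = (\<Sum>n<N. emeasure (return borel (x n)) A) / of_nat N"
proof (rule emeasure_measure_of[OF empirical_measure_def])
  show "countably_additive (sets (empirical_measure x N))
          (\<lambda>A. (\<Sum>n<N. emeasure (return borel (x n)) A) / of_nat N)"
    unfolding countably_additive_def sets_empirical_measure
  proof (intro allI impI)
    fix B :: "nat \<Rightarrow> 'a set"
    assume B: "range B \<subseteq> sets borel" "disjoint_family B"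
    have "(\<Sum>i. (\<Sum>n<N. emeasure (return borel (x n)) (B i)) / of_nat N)
        = (\<Sum>i. \<Sum>n<N. emeasure (return borel (x n)) (B i)) / of_nat N"
      by (rule ennreal_suminf_divide)
    also have "(\<Sum>i. \<Sum>n<N. emeasure (return borel (x n)) (B i))
        = (\<Sum>n<N. \<Sum>i. emeasure (return borel (x n)) (B i))"
      by (rule suminf_sum) simp
    also have "\<dots> = (\<Sum>n<N. emeasure (return borel (x n)) (\<Union>i. B i))"
      using B by (intro sum.cong refl suminf_emeasure) auto
    finally show "(\<Sum>i. (\<Sum>n<N. emeasure (return borel (x n)) (B i)) / of_nat N)
        = (\<Sum>n<N. emeasure (return borel (x n)) (\<Union>i. B i)) / of_nat N" .
  qed
qed (use assms in \<open>auto simp: positive_def sets_empirical_measure\<close>)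

lemma empirical_measure_in_borel_prob_measures:
  assumes "N \<ge> 1"
  shows "empirical_measure x N \<in> borel_prob_measures"
proof -
  have "space (empirical_measure x N) = UNIV"
    using sets_eq_imp_space_eq[OF sets_empirical_measure[of x N]] by simp
  moreover have "emeasure (empirical_measure x N) UNIV = 1"
    using assms
    by (simp add: emeasure_empirical_measure ennreal_divide_self ennreal_of_nat_eq_real_of_nat)
  ultimately have "prob_space (empirical_measure x N)"
    by (intro prob_spaceI) simp
  then show ?thesis
    by (simp add: space_prob_algebra sets_empirical_measure)
qed

definition empirical_limits :: "(nat \<Rightarrow> 'a::topological_space) \<Rightarrow> 'a measure set" where
  "empirical_limits x =
     (\<Inter>N\<^sub>0\<in>{1..}. weak_topology closure_of {empirical_measure x N | N. N \<ge> N\<^sub>0})"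

definition maldistributed :: "(nat \<Rightarrow> 'a::topological_space) \<Rightarrow> bool" where
  "maldistributed x \<longleftrightarrow> empirical_limits x = borel_prob_measures"

definition nowhere_dense :: "'a::topological_space set \<Rightarrow> bool" where
  "nowhere_dense S \<longleftrightarrow> interior (closure S) = {}"

definition meager :: "'a::topological_space set \<Rightarrow> bool" where
  "meager S \<longleftrightarrow> (\<exists>A :: nat \<Rightarrow> 'a set. (\<forall>i. nowhere_dense (A i)) \<and> S = (\<Union>i. A i))"

definition residual :: "'a::topological_space set \<Rightarrow> bool" where
  "residual S \<longleftrightarrow> meager (- S)"

end

theory Submission
  imports Defs
begin

text \<open>Averages of finite lists of rational points are weakly dense among the probability measures on
  the circle, so it suffices to approximate countably many such averages. Given a rational list \<open>c\<close>
  of length \<open>q\<close> and \<open>m\<close>, consider the \<open>\<alpha>\<close> for which, for some \<open>L \<ge> m\<close>, every \<open>n\<^sub>k \<alpha>\<close> with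
  \<open>L \<le> k < m L q\<close> lies within \<open>1/m\<close> of the \<open>k mod q\<close>-th entry of \<open>c\<close>. Then the first \<open>L\<close> terms are
  a negligible part of the first \<open>m L q\<close> ones, and the empirical measure at \<open>m L q\<close> is close to the
  average of \<open>c\<close>. The set of these \<open>\<alpha>\<close> is open, and it is dense because the growth of
  \<open>n\<^sub>k\<^sub>+\<^sub>1 / n\<^sub>k\<close> lets one prescribe the \<open>n\<^sub>k \<alpha>\<close> approximately by nested intervals.\<close>

section \<open>The circle as a quotient of the real line\<close>

lemma to_circle_eq_iff: "to_circle x = to_circle y \<longleftrightarrow> x - y \<in> \<int>"
  by (rule circle.abs_eq_iff)

lemma surj_to_circle: "surj to_circle"
  by (metis Quotient_circle Quotient_abs_rep surjI)

lemma continuous_to_circle: "continuous_on UNIV to_circle"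
  by (auto simp: continuous_on_open_vimage open_circle_def)

text \<open>The preimage of the image is the union of all integer translates of \<open>S\<close>,
  each of them open.\<close>

lemma open_image_to_circle:
  assumes "open S"
  shows "open (to_circle ` S)"
proof -
  have "to_circle -` (to_circle ` S) = (\<Union>z\<in>\<int>. (+) z ` S)"
  proof (intro equalityI subsetI)
    fix x assume "x \<in> to_circle -` (to_circle ` S)"
    then obtain s where s: "s \<in> S" "x - s \<in> \<int>"
      by (auto simp: to_circle_eq_iff)
    then have "x = (x - s) + s" by simp
    with s show "x \<in> (\<Union>z\<in>\<int>. (+) z ` S)" by blast
  next
    fix x assume "x \<in> (\<Union>z\<in>\<int>. (+) z ` S)"
    then obtain z s where "z \<in> \<int>" "s \<in> S" "x = z + s" by blast
    then show "x \<in> to_circle -` (to_circle ` S)"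
      by (auto intro!: image_eqI[of _ _ s] simp: to_circle_eq_iff)
  qed
  moreover have "open (\<Union>z\<in>\<int>. (+) z ` S)"
    using assms by (intro open_UN ballI open_translation)
  ultimately show ?thesis
    by (simp add: open_circle_def)
qed

lemma circle_mult_to_circle: "circle_mult m (to_circle x) = to_circle (real m * x)"
  by (rule circle_mult.abs_eq)

lemma continuous_circle_mult: "continuous_on UNIV (circle_mult m)"
proof -
  have "open (circle_mult m -` U)" if "open U" for U
  proof -
    have "to_circle -` (circle_mult m -` U) = (\<lambda>x. real m * x) -` (to_circle -` U)"
      by (auto simp: circle_mult_to_circle)
    moreover have "open ((\<lambda>x. real m * x) -` (to_circle -` U))"
      using that by (intro open_vimage[OF _ continuous_on_mult_const]) (simp add: open_circle_def)
    ultimately show ?thesis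
      by (simp add: open_circle_def)
  qed
  then show ?thesis
    by (simp add: continuous_on_open_vimage)
qed

text \<open>Fractional parts supply representatives in the compact interval
  \<open>{0..1}\<close>.\<close>

lemma compact_circle: "compact (UNIV :: circle set)"
proof -
  have "to_circle ` {0..1} = UNIV"
  proof (intro equalityI subsetI UNIV_I)
    fix y :: circle
    obtain x where "y = to_circle x" using surj_to_circle by (metis surjD)
    moreover have "to_circle x = to_circle (frac x)"
      by (simp add: to_circle_eq_iff frac_def)
    ultimately show "y \<in> to_circle ` {0..1}"
      using frac_ge_0[of x] frac_lt_1[of x] by (auto intro!: image_eqI[of _ _ "frac x"])
  qed
  then show ?thesis
    by (metis compact_Icc compact_continuous_image continuous_on_subset continuous_to_circle subset_UNIV)
qed

text \<open>Rational points are the countable dense set from which target patterns are drawn;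
  countability is what permits a Baire category argument.\<close>

lemma closure_rational_circle: "closure (range (\<lambda>r. to_circle (of_rat r))) = UNIV"
proof -
  have dense: False if W: "W \<noteq> {}" "W = - closure (range (\<lambda>r. to_circle (of_rat r)))" for W
  proof -
    have "open W" unfolding W(2) by (intro open_Compl closed_closure)
    obtain y where "y \<in> W" using W(1) by blast
    obtain x where "y = to_circle x" using surj_to_circle by (metis surjD)
    with \<open>y \<in> W\<close> have "x \<in> to_circle -` W" by simp
    moreover have "open (to_circle -` W)" using \<open>open W\<close> by (simp add: open_circle_def)
    ultimately obtain e where e: "e > 0" "ball x e \<subseteq> to_circle -` W"
      by (metis openE)
    obtain r where "x < of_rat r" "of_rat r < x + e"
      using of_rat_dense[of x "x + e"] e by auto
    then have "of_rat r \<in> ball x e" by (simp add: dist_real_def)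
    with e(2) have "to_circle (of_rat r) \<in> W" by blast
    then show False
      using W(2) closure_subset[of "range (\<lambda>r. to_circle (of_rat r))"] by blast
  qed
  show ?thesis
  proof (rule ccontr)
    assume "closure (range (\<lambda>r. to_circle (of_rat r))) \<noteq> UNIV"
    then have "- closure (range (\<lambda>r. to_circle (of_rat r))) \<noteq> {}"
      by (metis Compl_empty_eq double_complement)
    then show False using refl by (rule dense)
  qed
qed

text \<open>The circle carries only a topology here, so a quantitative form of continuity is
  obtained by lifting to the line: images of real balls serve as neighbourhoods.\<close>

lemma lift_circle_near:
  assumes "continuous_on UNIV (f :: circle \<Rightarrow> real)" "e > 0"
  shows "\<exists>d>0. \<forall>z\<in>to_circle ` ball t d. \<bar>f z - f (to_circle t)\<bar> < e"
proof -
  have "continuous_on UNIV (\<lambda>s. f (to_circle s))"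
    by (rule continuous_on_compose2[OF assms(1) continuous_to_circle]) simp
  then obtain d where "d > 0" "\<And>s. dist s t < d \<Longrightarrow> dist (f (to_circle s)) (f (to_circle t)) < e"
    using assms(2) unfolding continuous_on_iff by (metis UNIV_I)
  then show ?thesis
    by (intro exI[of _ d]) (auto simp: dist_commute simp flip: dist_real_def)
qed

section \<open>Empirical measures and weak neighbourhoods\<close>

text \<open>Read as the law of \<open>x\<close> at a uniformly chosen index, the empirical measure
  has its integrals given by the change of variables formula.\<close>

lemma empirical_measure_eq_distr:
  assumes "N \<ge> 1"
  shows "empirical_measure x N = distr (uniform_count_measure {..<N}) borel x"
proof (rule measure_eqI)
  fix A assume "A \<in> sets (empirical_measure x N)"
  then have A: "A \<in> sets borel" by (simp add: sets_empirical_measure)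
  have "(\<Sum>n<N. emeasure (return borel (x n)) A) = of_nat (card (x -` A \<inter> {..<N}))"
    using A by (simp add: indicator_def sum.If_cases Int_def vimage_def conj_commute flip: of_nat_sum)
  then show "emeasure (empirical_measure x N) A = emeasure (distr (uniform_count_measure {..<N}) borel x) A"
    using A assms
    by (simp add: emeasure_empirical_measure emeasure_distr emeasure_uniform_count_measure
        space_uniform_count_measure sets_uniform_count_measure measurable_def
        ennreal_of_nat_eq_real_of_nat divide_ennreal)
qed (simp add: sets_empirical_measure)

lemma integral_empirical_measure:
  assumes "N \<ge> 1" "(f :: 'a::topological_space \<Rightarrow> real) \<in> borel_measurable borel"
  shows "integral\<^sup>L (empirical_measure x N) f = (\<Sum>k<N. f (x k)) / real N"
proof -
  have "x \<in> measurable (uniform_count_measure {..<N}) borel"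
    by (simp add: measurable_def space_uniform_count_measure sets_uniform_count_measure)
  then show ?thesis
    using assms by (simp add: empirical_measure_eq_distr integral_distr integral_uniform_count_measure)
qed

text \<open>Induction on how \<open>T\<close> is generated: an intersection joins the two finite
  families of test functions and takes the smaller tolerance, a union uses one member containing
  \<open>\<mu>\<close>, and a subbasic set needs a single function.\<close>

lemma weak_topology_nhd:
  fixes T :: "'a::topological_space measure set"
  assumes "openin weak_topology T" "\<mu> \<in> T"
  shows "\<exists>F e. finite F \<and> e > 0 \<and> (\<forall>f\<in>F. continuous_on UNIV f \<and> bounded (range f)) \<and>
    {\<nu> \<in> borel_prob_measures. \<forall>f\<in>F. \<bar>integral\<^sup>L \<nu> f - integral\<^sup>L \<mu> f\<bar> < (e :: real)} \<subseteq> T"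
proof -
  have "generate_topology_on {{\<mu> \<in> borel_prob_measures. integral\<^sup>L \<mu> f \<in> U} | f U.
        continuous_on UNIV f \<and> bounded (range f) \<and> open (U :: real set)} T"
    using assms(1) by (simp add: weak_topology_def openin_topology_generated_by_iff)
  then show ?thesis
    using assms(2)
  proof induction
    case Empty
    then show ?case by simp
  next
    case (Int a b)
    from Int.prems have "\<mu> \<in> a" "\<mu> \<in> b" by auto
    from Int.IH(1)[OF this(1)] Int.IH(2)[OF this(2)]
    obtain F1 F2 :: "('a \<Rightarrow> real) set" and e1 e2 :: real where
      1: "finite F1" "e1 > 0" "\<forall>f\<in>F1. continuous_on UNIV f \<and> bounded (range f)"
         "{\<nu> \<in> borel_prob_measures. \<forall>f\<in>F1. \<bar>integral\<^sup>L \<nu> f - integral\<^sup>L \<mu> f\<bar> < e1} \<subseteq> a" and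
      2: "finite F2" "e2 > 0" "\<forall>f\<in>F2. continuous_on UNIV f \<and> bounded (range f)"
         "{\<nu> \<in> borel_prob_measures. \<forall>f\<in>F2. \<bar>integral\<^sup>L \<nu> f - integral\<^sup>L \<mu> f\<bar> < e2} \<subseteq> b"
      by (elim exE conjE)
    from 1 2 show ?case
      by (intro exI[of _ "F1 \<union> F2"] exI[of _ "min e1 e2"]) auto
  next
    case (UN K)
    then obtain k where k: "k \<in> K" "\<mu> \<in> k" by blast
    from UN.IH[OF k] obtain F :: "('a \<Rightarrow> real) set" and e :: real where "finite F" "e > 0" "\<forall>f\<in>F. continuous_on UNIV f \<and> bounded (range f)"
      "{\<nu> \<in> borel_prob_measures. \<forall>f\<in>F. \<bar>integral\<^sup>L \<nu> f - integral\<^sup>L \<mu> f\<bar> < e} \<subseteq> k"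
      by (elim exE conjE)
    with k(1) show ?case
      by (intro exI[of _ F] exI[of _ e] conjI) auto
  next
    case (Basis s)
    then obtain f U where s: "s = {\<mu> \<in> borel_prob_measures. integral\<^sup>L \<mu> f \<in> U}"
      "continuous_on UNIV f" "bounded (range f)" "open (U :: real set)" by blast
    with Basis obtain e where "e > 0" "ball (integral\<^sup>L \<mu> f) e \<subseteq> U"
      by (metis (no_types, lifting) mem_Collect_eq openE)
    with s show ?case
      by (intro exI[of _ "{f}"] exI[of _ e])
        (auto simp: dist_real_def abs_minus_commute subset_iff)
  qed
qed

section \<open>Approximating probability measures by averages over lists\<close>

text \<open>For a large length \<open>q\<close>, the point \<open>e i\<close> is repeated about
  \<open>q * p i\<close> times, rounded down, and the remaining places are filled with
  \<open>e 0\<close>. The rounding error is bounded independently of \<open>q\<close>, so it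
  vanishes after division by \<open>q\<close>.\<close>

lemma weights_approx_list:
  fixes p :: "nat \<Rightarrow> real" and e :: "nat \<Rightarrow> 'a" and F :: "('a \<Rightarrow> real) set"
  assumes p: "\<And>i. p i \<ge> 0" "(\<Sum>i<K. p i) = 1" and F: "finite F" and "\<epsilon> > 0"
  shows "\<exists>xs. xs \<noteq> [] \<and> set xs \<subseteq> e ` {..<K} \<and>
    (\<forall>f\<in>F. \<bar>(\<Sum>i<K. p i * f (e i)) - (\<Sum>i<length xs. f (xs ! i)) / length xs\<bar> < \<epsilon>)"
proof -
  \<comment> \<open>Bounds the error before division by \<open>q\<close>: rounding loses at most one
    copy of each \<open>e i\<close>, and at most \<open>K\<close> filler copies of
    \<open>e 0\<close> are added.\<close>
  define C where "C f = (\<Sum>i<K. \<bar>f (e i)\<bar>) + K * \<bar>f (e 0)\<bar>" for f :: "'a \<Rightarrow> real"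
  have "\<forall>\<^sub>F q in sequentially. \<forall>f\<in>F. C f / real q < \<epsilon>"
  proof (intro eventually_ball_finite F ballI)
    fix f
    have "(\<lambda>q. C f / real q) \<longlonglongrightarrow> 0"
      by (rule lim_const_over_n)
    then show "\<forall>\<^sub>F q in sequentially. C f / real q < \<epsilon>"
      using \<open>\<epsilon> > 0\<close> by (rule order_tendstoD)
  qed
  with eventually_gt_at_top[of 0] have "\<forall>\<^sub>F q in sequentially. q > 0 \<and> (\<forall>f\<in>F. C f / real q < \<epsilon>)"
    by (rule eventually_conj)
  then obtain q :: nat where q: "q > 0" "\<And>f. f \<in> F \<Longrightarrow> C f / real q < \<epsilon>"
    by (metis (no_types, lifting) eventually_happens trivial_limit_sequentially)
  define a where "a i = nat \<lfloor>q * p i\<rfloor>" for i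
  have a: "real (a i) \<le> q * p i" "q * p i - 1 \<le> real (a i)" for i
    using p(1)[of i] by (auto simp: a_def)
  define r where "r = q - (\<Sum>i<K. a i)"
  have "real (\<Sum>i<K. a i) \<le> (\<Sum>i<K. q * p i)"
    unfolding of_nat_sum by (intro sum_mono a)
  also have "\<dots> = q" using p(2) by (simp flip: sum_distrib_left)
  finally have le: "(\<Sum>i<K. a i) \<le> q" by (simp only: of_nat_le_iff)
  then have r: "real r = q - (\<Sum>i<K. real (a i))" by (simp add: r_def)
  have "(\<Sum>i<K. q * p i - 1) \<le> (\<Sum>i<K. real (a i))"
    by (intro sum_mono a)
  then have rK: "real r \<le> K"
    using p(2) by (simp add: r sum_subtractf flip: sum_distrib_left)
  define xs where "xs = concat (map (\<lambda>i. replicate (a i) (e i)) [0..<K]) @ replicate r (e 0)"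
  have len: "length xs = q"
    using le by (simp add: xs_def length_concat r_def comp_def interv_sum_list_conv_sum_set_nat atLeast0LessThan)
  have sum: "(\<Sum>i<length xs. f (xs ! i)) = (\<Sum>i<K. a i * f (e i)) + r * f (e 0)" for f :: "'a \<Rightarrow> real"
  proof -
    have c: "sum_list (map f (concat (map (\<lambda>i. replicate (a i) (e i)) is))) = (\<Sum>i\<leftarrow>is. a i * f (e i))" for "is"
      by (induction "is") (auto simp: sum_list_replicate map_replicate)
    have "(\<Sum>i<length xs. f (xs ! i)) = sum_list (map f xs)"
      by (simp add: sum_list_sum_nth atLeast0LessThan)
    also have "\<dots> = (\<Sum>i\<leftarrow>[0..<K]. a i * f (e i)) + r * f (e 0)"
      unfolding xs_def map_append sum_list_append c by (simp add: sum_list_replicate map_replicate)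
    finally show ?thesis
      by (simp add: interv_sum_list_conv_sum_set_nat atLeast0LessThan)
  qed
  have "\<bar>(\<Sum>i<K. p i * f (e i)) - (\<Sum>i<length xs. f (xs ! i)) / length xs\<bar> < \<epsilon>" if "f \<in> F" for f
  proof -
    have "\<bar>q * (\<Sum>i<K. p i * f (e i)) - (\<Sum>i<length xs. f (xs ! i))\<bar>
      = \<bar>(\<Sum>i<K. (q * p i - a i) * f (e i)) - r * f (e 0)\<bar>"
      by (simp add: sum sum_distrib_left algebra_simps sum_subtractf)
    also have "\<dots> \<le> (\<Sum>i<K. \<bar>(q * p i - a i) * f (e i)\<bar>) + \<bar>r * f (e 0)\<bar>"
      by (rule order_trans[OF abs_triangle_ineq4]) (intro add_mono sum_abs order_refl)
    also have "\<dots> \<le> (\<Sum>i<K. \<bar>f (e i)\<bar>) + K * \<bar>f (e 0)\<bar>"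
    proof (intro add_mono sum_mono)
      fix i show "\<bar>(q * p i - a i) * f (e i)\<bar> \<le> \<bar>f (e i)\<bar>"
        using a[of i] by (simp add: abs_mult mult_left_le_one_le)
    qed (use rK in \<open>simp add: abs_mult mult_right_mono\<close>)
    finally have *: "\<bar>q * (\<Sum>i<K. p i * f (e i)) - (\<Sum>i<length xs. f (xs ! i))\<bar> \<le> C f"
      by (simp add: C_def)
    have "(\<Sum>i<K. p i * f (e i)) - (\<Sum>i<length xs. f (xs ! i)) / length xs
      = (q * (\<Sum>i<K. p i * f (e i)) - (\<Sum>i<length xs. f (xs ! i))) / q"
      using q(1) by (simp add: len field_simps)
    then have "\<bar>(\<Sum>i<K. p i * f (e i)) - (\<Sum>i<length xs. f (xs ! i)) / length xs\<bar> \<le> C f / q"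
      using * by (simp add: abs_divide divide_right_mono)
    with q(2)[OF that] show ?thesis by linarith
  qed
  moreover have "xs \<noteq> []" using len q(1) by auto
  \<comment> \<open>Weights with sum 1 cannot be an empty family, so the filler \<open>e 0\<close>
    is itself one of the allowed points.\<close>
  moreover have "K > 0" using p(2) by (cases K) auto
  then have "set xs \<subseteq> e ` {..<K}" by (auto simp: xs_def)
  ultimately show ?thesis by blast
qed

text \<open>By compactness, finitely many open sets, each centred at a point of \<open>D\<close> and
  on which every \<open>f \<in> F\<close> stays within \<open>\<epsilon> / 2\<close> of its value at
  the centre, cover the space. Moving the mass of \<open>\<mu>\<close> to the centres costs at most
  \<open>\<epsilon> / 2\<close>, and replacing the resulting weights by a list costs less than
  \<open>\<epsilon> / 2\<close>.\<close>

lemma prob_measure_approx_list: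
  fixes F :: "('a::topological_space \<Rightarrow> real) set"
  assumes \<mu>: "\<mu> \<in> borel_prob_measures" and "compact (UNIV :: 'a set)" and D: "closure D = UNIV"
    and F: "finite F" "\<And>f. f \<in> F \<Longrightarrow> continuous_on UNIV f" and "\<epsilon> > 0"
  shows "\<exists>xs. xs \<noteq> [] \<and> set xs \<subseteq> D \<and>
    (\<forall>f\<in>F. \<bar>integral\<^sup>L \<mu> f - (\<Sum>i<length xs. f (xs ! i)) / length xs\<bar> < \<epsilon>)"
proof -
  interpret prob_space \<mu> using \<mu> by (simp add: space_prob_algebra)
  have sets [measurable_cong]: "sets \<mu> = sets borel" using \<mu> by (simp add: space_prob_algebra)
  have space: "space \<mu> = UNIV" using sets_eq_imp_space_eq[OF sets] by simp
  define V where "V d = (\<Inter>f\<in>F. {y. \<bar>f y - f d\<bar> < \<epsilon> / 2})" for d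
  have openV: "open (V d)" for d
    unfolding V_def using F by (intro open_INT ballI open_Collect_less continuous_intros)
  \<comment> \<open>Density puts some \<open>d \<in> D\<close> into \<open>V y\<close>; symmetry
    turns this into \<open>y \<in> V d\<close>, which is what a cover requires.\<close>
  have sym: "x \<in> V y \<longleftrightarrow> y \<in> V x" for x y
    by (simp add: V_def abs_minus_commute)
  have "UNIV \<subseteq> (\<Union>d\<in>D. V d)"
  proof
    fix y
    have "y \<in> V y" using \<open>\<epsilon> > 0\<close> by (simp add: V_def)
    then have "D \<inter> V y \<noteq> {}"
      using openV[of y] D by (metis UNIV_I disjoint_iff open_Int_closure_eq_empty inf_commute)
    then show "y \<in> (\<Union>d\<in>D. V d)" using sym by blast
  qed
  then obtain D0 where D0: "D0 \<subseteq> D" "finite D0" "UNIV \<subseteq> (\<Union>d\<in>D0. V d)"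
    using assms(2) openV by (metis compactE_image)
  then obtain K :: nat and e where K: "e ` {..<K} = D0"
    by (metis finite_imp_nat_seg_image_inj_on lessThan_def)
  \<comment> \<open>Choosing the least index turns the overlapping cover into a finite measurable
    partition, whose cells carry the weights \<open>p i\<close>.\<close>
  define idx where "idx y = (LEAST i. y \<in> V (e i))" for y
  have ex: "\<exists>i<K. y \<in> V (e i)" for y using D0(3) K by force
  have idx: "y \<in> V (e (idx y))" for y
    unfolding idx_def using ex[of y] by (metis LeastI_ex)
  have idxK: "idx y < K" for y
    unfolding idx_def using ex[of y] by (metis Least_le le_less_trans)
  have [measurable]: "V d \<in> sets borel" for d using openV by simp
  have [measurable]: "idx \<in> measurable borel (count_space UNIV)"
    unfolding idx_def by measurable
  define p where "p i = prob {y. idx y = i}" for i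
  have ms: "{y. idx y = i} \<in> events" for i
    by measurable
  have eq: "integral\<^sup>L \<mu> (\<lambda>y. g (idx y)) = (\<Sum>i<K. p i * g i)" for g :: "nat \<Rightarrow> real"
  proof -
    have "(\<lambda>y. g (idx y)) = (\<lambda>y. \<Sum>i<K. g i * indicator {y. idx y = i} y)"
      using idxK by (auto simp: indicator_def)
    then have "integral\<^sup>L \<mu> (\<lambda>y. g (idx y)) = integral\<^sup>L \<mu> (\<lambda>y. \<Sum>i<K. g i * indicator {y. idx y = i} y)"
      by (rule arg_cong)
    also have "\<dots> = (\<Sum>i<K. integral\<^sup>L \<mu> (\<lambda>y. g i * indicator {y. idx y = i} y))"
      using ms by (intro Bochner_Integration.integral_sum integrable_mult_right integrable_real_indicator)
        (auto simp: emeasure_eq_measure)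
    also have "\<dots> = (\<Sum>i<K. g i * p i)"
      by (simp add: p_def space)
    finally show ?thesis by (simp add: mult.commute)
  qed
  have "(\<Sum>i<K. p i) = 1" using eq[of "\<lambda>_. 1"] by (simp add: prob_space)
  then obtain xs where xs: "xs \<noteq> []" "set xs \<subseteq> e ` {..<K}"
    "\<forall>f\<in>F. \<bar>(\<Sum>i<K. p i * f (e i)) - (\<Sum>i<length xs. f (xs ! i)) / length xs\<bar> < \<epsilon> / 2"
    using weights_approx_list[of p K F "\<epsilon> / 2" e] F(1) \<open>\<epsilon> > 0\<close> by (auto simp: p_def)
  have "\<bar>integral\<^sup>L \<mu> f - (\<Sum>i<K. p i * f (e i))\<bar> \<le> \<epsilon> / 2" if "f \<in> F" for f
  proof -
    have [measurable]: "f \<in> borel_measurable borel"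
      using F(2)[OF that] by (rule borel_measurable_continuous_onI)
    have "bounded (range f)"
      using F(2)[OF that] assms(2) by (intro compact_imp_bounded compact_continuous_image)
    then obtain B where "\<And>x. \<bar>f x\<bar> \<le> B" by (auto simp: bounded_iff)
    then have int: "integrable \<mu> f" by (intro integrable_const_bound[of _ B]) auto
    have int2: "integrable \<mu> (\<lambda>y. f (e (idx y)))"
      using \<open>\<And>x. \<bar>f x\<bar> \<le> B\<close> by (intro integrable_const_bound[of _ B]) auto
    have close: "\<bar>f y - f (e (idx y))\<bar> \<le> \<epsilon> / 2" for y
      using idx[of y] that by (auto simp: V_def less_imp_le)
    have "integral\<^sup>L \<mu> f - (\<Sum>i<K. p i * f (e i)) = integral\<^sup>L \<mu> (\<lambda>y. f y - f (e (idx y)))"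
      using int int2 eq[of "\<lambda>i. f (e i)"] by simp
    also have "\<bar>\<dots>\<bar> \<le> integral\<^sup>L \<mu> (\<lambda>y. \<bar>f y - f (e (idx y))\<bar>)"
      by (rule integral_abs_bound)
    also have "\<dots> \<le> \<epsilon> / 2"
      using close int int2 by (intro integral_le_const) auto
    finally show ?thesis .
  qed
  moreover have "\<bar>u - w\<bar> < \<epsilon>" if "\<bar>u - v\<bar> \<le> \<epsilon> / 2" "\<bar>v - w\<bar> < \<epsilon> / 2" for u v w :: real
    using that by argo
  ultimately have "\<forall>f\<in>F. \<bar>integral\<^sup>L \<mu> f - (\<Sum>i<length xs. f (xs ! i)) / length xs\<bar> < \<epsilon>"
    using xs(3) by blast
  with xs(1,2) K D0(1) show ?thesis by blast
qed

section \<open>Following a periodic pattern controls the averages\<close>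

lemma sum_mod_period:
  fixes g :: "nat \<Rightarrow> real"
  shows "(\<Sum>k<M*q. g (k mod q)) = M * (\<Sum>i<q. g i)"
proof (induction M)
  case (Suc M)
  have split: "(\<Sum>k<a + b. h k) = (\<Sum>k<a. h k) + (\<Sum>k<b. h (a + k))" for h :: "nat \<Rightarrow> real" and a b
    by (induction b) auto
  show ?case
    using split[of "\<lambda>k. g (k mod q)" "M * q" q] Suc by (simp add: algebra_simps)
qed simp

text \<open>The range of \<open>k\<close> is empty, and the condition vacuous, if \<open>m = 0\<close> or \<open>c = []\<close>.\<close>

definition tracks :: "(nat \<Rightarrow> circle) \<Rightarrow> rat list \<Rightarrow> nat \<Rightarrow> nat \<Rightarrow> bool" where
  "tracks x c m L \<longleftrightarrow>
     (\<forall>k. L \<le> k \<and> k < m * L * length c \<longrightarrow>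
        x k \<in> to_circle ` ball (of_rat (c ! (k mod length c))) (1 / real m))"

text \<open>Only the first \<open>L\<close> of the \<open>m * L * length c\<close> terms are
  uncontrolled, and they change the average by at most \<open>2 * B / m\<close>, where
  \<open>B\<close> bounds \<open>\<bar>f\<bar>\<close>. Every other term is close to its target by
  continuity. The threshold for \<open>m\<close> depends on \<open>f\<close>, \<open>c\<close> and
  \<open>\<epsilon>\<close> but not on \<open>x\<close> or \<open>L\<close>.\<close>

lemma tracks_average:
  fixes f :: "circle \<Rightarrow> real"
  assumes f: "continuous_on UNIV f" and c: "c \<noteq> []" and "\<epsilon> > 0"
  shows "\<forall>\<^sub>F m in sequentially. \<forall>x L. L > 0 \<and> tracks x c m L \<longrightarrow>
    \<bar>(\<Sum>k<m*L*length c. f (x k)) / real (m*L*length c)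
      - (\<Sum>i<length c. f (to_circle (of_rat (c ! i)))) / length c\<bar> < \<epsilon>"
proof -
  define y where "y i = to_circle (of_rat (c ! i))" for i
  define q where "q = length c"
  have q: "q > 0" using c by (simp add: q_def)
  have "bounded (range f)"
    using f compact_circle by (intro compact_imp_bounded compact_continuous_image)
  then obtain B where B: "\<And>x. \<bar>f x\<bar> \<le> B" by (auto simp: bounded_iff)
  have "(\<lambda>m. 2 * B / real m) \<longlonglongrightarrow> 0" by (rule lim_const_over_n)
  then have ev1: "\<forall>\<^sub>F m in sequentially. 2 * B / real m < \<epsilon> / 2"
    using \<open>\<epsilon> > 0\<close> by (intro order_tendstoD) auto
  \<comment> \<open>Only the \<open>q\<close> entries of \<open>c\<close> occur as centres, so one
    threshold on \<open>m\<close> serves all of them.\<close>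
  have ev2: "\<forall>\<^sub>F m in sequentially. \<forall>i\<in>{..<q}. \<forall>z\<in>to_circle ` ball (of_rat (c ! i)) (1 / real m).
     \<bar>f z - f (y i)\<bar> < \<epsilon> / 2"
  proof (intro eventually_ball_finite ballI finite_lessThan)
    fix i
    obtain d where d: "d > 0" "\<forall>z\<in>to_circle ` ball (of_rat (c ! i)) d. \<bar>f z - f (y i)\<bar> < \<epsilon> / 2"
      using lift_circle_near[OF f, of "\<epsilon> / 2" "of_rat (c ! i)"] \<open>\<epsilon> > 0\<close> by (auto simp: y_def)
    have "(\<lambda>m. 1 / real m) \<longlonglongrightarrow> 0" by (rule lim_const_over_n)
    then have "\<forall>\<^sub>F m in sequentially. 1 / real m < d" using d by (intro order_tendstoD)
    then show "\<forall>\<^sub>F m in sequentially. \<forall>z\<in>to_circle ` ball (of_rat (c ! i)) (1 / real m). \<bar>f z - f (y i)\<bar> < \<epsilon> / 2"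
      by eventually_elim (use d in force)
  qed
  show ?thesis
    using ev1 ev2 eventually_gt_at_top[of 0]
  proof eventually_elim
    case (elim m)
    show ?case
    proof (intro allI impI)
      fix x L assume L: "L > 0 \<and> tracks x c m L"
      define N where "N = m * L * q"
      have N: "N > 0" using q L elim by (simp add: N_def)
      have "L \<le> N" using q elim by (simp add: N_def)
      have nonneg: "B \<ge> 0" using B[of undefined] by linarith
      have "\<bar>f (x k) - f (y (k mod q))\<bar> \<le> \<epsilon> / 2 + (if k < L then 2 * B else 0)" if "k < N" for k
      proof (cases "k < L")
        case True
        then show ?thesis using B[of "x k"] B[of "y (k mod q)"] \<open>\<epsilon> > 0\<close> by simp
      next
        case False
        then have "x k \<in> to_circle ` ball (of_rat (c ! (k mod q))) (1 / real m)"
          using L that by (simp add: tracks_def N_def q_def)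
        then show ?thesis using elim(2) q False by (auto simp: less_imp_le)
      qed
      then have "(\<Sum>k<N. \<bar>f (x k) - f (y (k mod q))\<bar>) \<le> (\<Sum>k<N. \<epsilon> / 2 + (if k < L then 2 * B else 0))"
        by (intro sum_mono) simp
      also have "\<dots> = N * (\<epsilon> / 2) + L * (2 * B)"
      proof -
        have "{..<N} \<inter> {k. k < L} = {..<L}" using \<open>L \<le> N\<close> by auto
        then show ?thesis by (simp add: sum.distrib sum.If_cases)
      qed
      finally have "\<bar>(\<Sum>k<N. f (x k)) - (\<Sum>k<N. f (y (k mod q)))\<bar> \<le> N * (\<epsilon> / 2) + L * (2 * B)"
          unfolding sum_subtractf[symmetric] by (rule order_trans[OF sum_abs])
      \<comment> \<open>\<open>N\<close> consists of \<open>m * L\<close> full periods, so the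
        periodic pattern has exactly the average of \<open>c\<close>, with no boundary term.\<close>
      moreover have "(\<Sum>k<N. f (y (k mod q))) = m * L * (\<Sum>i<q. f (y i))"
        unfolding N_def by (subst sum_mod_period[where g = "\<lambda>i. f (y i)"]) simp
      ultimately have "\<bar>(\<Sum>k<N. f (x k)) - m * L * (\<Sum>i<q. f (y i))\<bar> / N \<le> (N * (\<epsilon> / 2) + L * (2 * B)) / N"
        by (simp add: divide_right_mono)
      also have "\<dots> = \<epsilon> / 2 + 2 * B / m / q"
        using N L elim q by (simp add: N_def field_simps)
      also have "\<dots> \<le> \<epsilon> / 2 + 2 * B / m"
        using q nonneg divide_left_mono[of 1 "real q" "2 * B / m"] by simp
      also have "\<dots> < \<epsilon>" using elim by simp
      also have "\<bar>(\<Sum>k<N. f (x k)) - m * L * (\<Sum>i<q. f (y i))\<bar> / N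
        = \<bar>(\<Sum>k<N. f (x k)) / N - (\<Sum>i<q. f (y i)) / q\<bar>"
      proof -
        have "(\<Sum>k<N. f (x k)) / N - (\<Sum>i<q. f (y i)) / q = ((\<Sum>k<N. f (x k)) - m * L * (\<Sum>i<q. f (y i))) / N"
          using N L elim q by (simp add: N_def field_simps)
        then show ?thesis by simp
      qed
      finally show "\<bar>(\<Sum>k<m*L*length c. f (x k)) / real (m*L*length c)
          - (\<Sum>i<length c. f (to_circle (of_rat (c ! i)))) / length c\<bar> < \<epsilon>"
        by (simp only: N_def q_def y_def)
    qed
  qed
qed

text \<open>A basic weak neighbourhood of \<open>\<mu>\<close> involves finitely many test
  functions. A rational list approximates \<open>\<mu>\<close> on them, and a long tracked stretch
  makes an empirical measure, with \<open>N\<close> as large as desired, approximate the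
  list.\<close>

lemma maldistributed_if_tracks:
  assumes "\<And>c m. \<exists>L\<ge>m. tracks x c m L"
  shows "maldistributed x"
proof -
  have "\<mu> \<in> weak_topology closure_of {empirical_measure x N | N. N \<ge> N0}"
    if \<mu>: "\<mu> \<in> borel_prob_measures" for \<mu> N0
    unfolding in_closure_of topspace_weak_topology
  proof (intro conjI allI impI \<mu>)
    fix T assume "\<mu> \<in> T \<and> openin weak_topology T"
    then obtain F and \<epsilon> :: real where F: "finite F" "\<epsilon> > 0" "\<forall>f\<in>F. continuous_on UNIV f \<and> bounded (range f)"
      "{\<nu> \<in> borel_prob_measures. \<forall>f\<in>F. \<bar>integral\<^sup>L \<nu> f - integral\<^sup>L \<mu> f\<bar> < \<epsilon>} \<subseteq> T"
      using weak_topology_nhd[of T \<mu>] by blast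
    \<comment> \<open>Half of the tolerance is spent on passing from \<open>\<mu>\<close> to a list,
      the other half on passing from the list to an empirical measure.\<close>
    obtain xs where xs: "xs \<noteq> []" "set xs \<subseteq> range (\<lambda>r. to_circle (of_rat r))"
      "\<forall>f\<in>F. \<bar>integral\<^sup>L \<mu> f - (\<Sum>i<length xs. f (xs ! i)) / length xs\<bar> < \<epsilon> / 2"
      using prob_measure_approx_list[OF \<mu> compact_circle closure_rational_circle F(1), of "\<epsilon> / 2"] F(2,3)
      by auto
    obtain c where c: "xs = map (\<lambda>r. to_circle (of_rat r)) c"
      using xs(2) by (metis ex_map_conv image_iff subsetD)
    with xs have "c \<noteq> []" by simp
    then have "\<forall>\<^sub>F m in sequentially. \<forall>f\<in>F. \<forall>x L. L > 0 \<and> tracks x c m L \<longrightarrow>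
      \<bar>(\<Sum>k<m*L*length c. f (x k)) / real (m*L*length c)
        - (\<Sum>i<length c. f (to_circle (of_rat (c ! i)))) / length c\<bar> < \<epsilon> / 2"
      using F by (intro eventually_ball_finite ballI tracks_average) auto
    \<comment> \<open>Asking for \<open>Suc N0\<close> makes \<open>m\<close> positive. Then
      \<open>L \<ge> m\<close> is positive too, and \<open>N \<ge> m\<close> gives both
      \<open>N \<ge> N0\<close> and \<open>N \<ge> 1\<close>.\<close>
    from eventually_happens[OF eventually_conj[OF this eventually_ge_at_top[of "Suc N0"]]]
    obtain m where m: "m \<ge> Suc N0"
      and av: "\<forall>f\<in>F. \<forall>x L. L > 0 \<and> tracks x c m L \<longrightarrow>
      \<bar>(\<Sum>k<m*L*length c. f (x k)) / real (m*L*length c)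
        - (\<Sum>i<length c. f (to_circle (of_rat (c ! i)))) / length c\<bar> < \<epsilon> / 2"
      by (elim disjE exE conjE) auto
    obtain L where L: "L \<ge> m" "tracks x c m L" using assms by blast
    define N where "N = m * L * length c"
    have "m * 1 * 1 \<le> N" unfolding N_def
      using L m \<open>c \<noteq> []\<close> by (intro mult_le_mono) (auto simp: Suc_le_eq)
    with m have N: "N \<ge> N0" "N \<ge> 1" by auto
    have "\<bar>integral\<^sup>L (empirical_measure x N) f - integral\<^sup>L \<mu> f\<bar> < \<epsilon>" if "f \<in> F" for f
    proof -
      have "f \<in> borel_measurable borel"
        using F(3) that by (blast intro: borel_measurable_continuous_onI)
      then have "integral\<^sup>L (empirical_measure x N) f = (\<Sum>k<N. f (x k)) / real N"
        using N by (intro integral_empirical_measure)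
      moreover have "\<bar>(\<Sum>k<N. f (x k)) / real N - (\<Sum>i<length c. f (to_circle (of_rat (c ! i)))) / length c\<bar> < \<epsilon> / 2"
        unfolding N_def using av that L m by auto
      moreover have "\<bar>integral\<^sup>L \<mu> f - (\<Sum>i<length c. f (to_circle (of_rat (c ! i)))) / length c\<bar> < \<epsilon> / 2"
        using xs(3) that by (simp add: c)
      ultimately show ?thesis by argo
    qed
    then have "empirical_measure x N \<in> T"
      using F(4) empirical_measure_in_borel_prob_measures[OF N(2)] by blast
    with N(1) show "\<exists>\<nu>. \<nu> \<in> {empirical_measure x N | N. N \<ge> N0} \<and> \<nu> \<in> T" by blast
  qed
  moreover have "empirical_limits x \<subseteq> borel_prob_measures"
    unfolding empirical_limits_def
    using closure_of_subset_topspace[of weak_topology] by (fastforce simp: topspace_weak_topology)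
  ultimately show ?thesis
    unfolding maldistributed_def empirical_limits_def by blast
qed

section \<open>Prescribing multiples by nested intervals\<close>

text \<open>An interval of length \<open>2 / n k\<close> contains a point where
  \<open>n k * s\<close> agrees with \<open>y k\<close> modulo 1, followed by a subinterval of
  length \<open>\<delta> / (2 * n k)\<close> on which the error stays below \<open>\<delta>\<close>.
  The ratio bound makes this subinterval long enough for the index \<open>Suc k\<close>, so the
  choices can be nested.\<close>

lemma lacunary_steering:
  fixes n :: "nat \<Rightarrow> nat" and y :: "nat \<Rightarrow> real"
  assumes pos: "\<And>k. n k > 0" and \<delta>: "0 < \<delta>" "\<delta> \<le> 1"
    and ratio: "\<forall>k\<ge>L. real (n (Suc k)) / real (n k) \<ge> 4 / \<delta>"
    and start: "r \<ge> 2 / real (n L)"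
  shows "\<exists>t. {t..t + \<delta> / (2 * n (L + j))} \<subseteq> {a..a + r} \<and>
    (\<forall>s\<in>{t..t + \<delta> / (2 * n (L + j))}. \<forall>k\<in>{L..L+j}. \<exists>z\<in>\<int>. \<bar>n k * s - (y k + z)\<bar> < \<delta>)"
proof -
  have step: "\<exists>t. {t..t + \<delta> / (2 * n k)} \<subseteq> {b..b + l} \<and>
    (\<forall>s\<in>{t..t + \<delta> / (2 * n k)}. \<exists>z\<in>\<int>. \<bar>n k * s - (y k + z)\<bar> < \<delta>)"
    if l: "l \<ge> 2 / real (n k)" for k b l
  proof -
    \<comment> \<open>Rounding up makes \<open>t\<close> the first exact hit at or after
      \<open>b\<close>, hence at most \<open>1 / n k\<close> beyond it. The other
      \<open>1 / n k\<close> leaves room for the subinterval, as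
      \<open>\<delta> \<le> 1\<close>.\<close>
    define z where "z = \<lceil>n k * b - y k\<rceil>"
    define t where "t = (y k + z) / n k"
    have nk: "real (n k) > 0" using pos by simp
    have z: "n k * b \<le> y k + z" "y k + z \<le> n k * b + 1"
      unfolding z_def by linarith+
    have "b \<le> t" using z nk by (simp add: t_def field_simps)
    moreover have "t \<le> (n k * b + 1) / n k"
      unfolding t_def using z nk by (intro divide_right_mono) auto
    then have "t \<le> b + 1 / n k" using nk by (simp add: add_divide_distrib)
    moreover have "\<delta> / (2 * n k) \<le> 1 / n k" using nk \<delta> by (simp add: field_simps)
    ultimately have "{t..t + \<delta> / (2 * n k)} \<subseteq> {b..b + l}" using l by auto
    moreover have "\<bar>n k * s - (y k + z)\<bar> < \<delta>" if "s \<in> {t..t + \<delta> / (2 * n k)}" for s :: real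
    proof -
      have "n k * t \<le> n k * s" "n k * s \<le> n k * (t + \<delta> / (2 * n k))"
        using that nk by (auto intro!: mult_left_mono simp del: mult_le_cancel_left_pos)
      moreover have "n k * t = y k + z" "n k * (t + \<delta> / (2 * n k)) = y k + z + \<delta> / 2"
        using nk by (auto simp: t_def field_simps)
      ultimately show ?thesis using \<delta> by linarith
    qed
    ultimately show ?thesis by (intro exI[of _ t]) (auto intro!: bexI[of _ "of_int z"])
  qed
  show ?thesis
  proof (induction j)
    case 0
    show ?case using step[OF start, of a] by simp
  next
    case (Suc j)
    then obtain t where t: "{t..t + \<delta> / (2 * n (L + j))} \<subseteq> {a..a + r}"
      "\<forall>s\<in>{t..t + \<delta> / (2 * n (L + j))}. \<forall>k\<in>{L..L+j}. \<exists>z\<in>\<int>. \<bar>n k * s - (y k + z)\<bar> < \<delta>"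
      by blast
    \<comment> \<open>This is where the constant \<open>4 / \<delta>\<close> comes from: it is the
      ratio at which the current interval meets the length requirement of the next index.\<close>
    have "\<delta> / (2 * n (L + j)) \<ge> 2 / real (n (L + Suc j))"
      using ratio[rule_format, of "L + j"] pos[of "L + j"] pos[of "L + Suc j"] \<delta> by (simp add: field_simps)
    from step[OF this, of t] obtain t' where t':
      "{t'..t' + \<delta> / (2 * n (L + Suc j))} \<subseteq> {t..t + \<delta> / (2 * n (L + j))}"
      "\<forall>s\<in>{t'..t' + \<delta> / (2 * n (L + Suc j))}. \<exists>z\<in>\<int>. \<bar>n (L + Suc j) * s - (y (L + Suc j) + z)\<bar> < \<delta>"
      by blast
    have "{L..L + Suc j} = insert (L + Suc j) {L..L+j}" by auto
    moreover have "{t'..t' + \<delta> / (2 * n (L + Suc j))} \<subseteq> {a..a + r}"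
      using t(1) t'(1) by (rule order_trans[rotated])
    ultimately show ?case
      using t(2) t'(1) t'(2) by (intro exI[of _ t'] conjI ballI) (simp_all only: insert_iff, blast)
  qed
qed

text \<open>Once the ratios exceed 1, the sequence is a strictly increasing sequence of naturals.
  Its divergence lets the steering start inside an arbitrarily short interval.\<close>

lemma filterlim_lacunary:
  fixes n :: "nat \<Rightarrow> nat"
  assumes "\<And>k. n k > 0"
    and "filterlim (\<lambda>k. real (n (Suc k)) / real (n k)) at_top sequentially"
  shows "filterlim (\<lambda>k. real (n k)) at_top sequentially"
proof -
  have "\<forall>\<^sub>F k in sequentially. real (n (Suc k)) / real (n k) > 1"
    using assms(2) by (simp add: filterlim_at_top_dense)
  then obtain K where K: "\<And>k. k \<ge> K \<Longrightarrow> real (n (Suc k)) / real (n k) > 1"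
    by (auto simp: eventually_sequentially)
  have "strict_mono (\<lambda>j. n (K + j))"
    using K assms(1) by (intro strict_monoI_Suc) (simp add: less_divide_eq)
  then have "filterlim (\<lambda>j. n (j + K)) sequentially sequentially"
    by (simp add: filterlim_subseq add.commute)
  then have "filterlim n sequentially sequentially"
    unfolding filterlim_iff by (simp add: eventually_sequentially_seg[where P = "\<lambda>k. _ (n k)"])
  then show ?thesis
    by (rule filterlim_compose[OF filterlim_real_sequentially])
qed

section \<open>The open dense tracking sets\<close>

text \<open>The single \<open>m\<close> is at once the least admissible \<open>L\<close>, the
  inverse of the tolerance and a factor of the length of the stretch, so that pairs of
  \<open>c\<close> and \<open>m\<close> index a countable family.\<close>

definition tracking_set :: "(nat \<Rightarrow> nat) \<Rightarrow> rat list \<Rightarrow> nat \<Rightarrow> circle set" where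
  "tracking_set n c m = {\<alpha>. \<exists>L\<ge>m. tracks (\<lambda>k. circle_mult (n k) \<alpha>) c m L}"

text \<open>For fixed \<open>L\<close> only finitely many \<open>k\<close> impose a condition, each
  of them open.\<close>

lemma open_tracking_set: "open (tracking_set n c m)"
proof -
  have "tracking_set n c m = (\<Union>L\<in>{m..}. \<Inter>k\<in>{L..<m * L * length c}.
    circle_mult (n k) -` (to_circle ` ball (of_rat (c ! (k mod length c))) (1 / real m)))"
    by (auto simp: tracking_set_def tracks_def)
  also have "open \<dots>"
    by (intro open_UN open_INT ballI finite_atLeastLessThan open_vimage
        continuous_circle_mult open_image_to_circle open_ball)
  finally show ?thesis .
qed

text \<open>\<open>W\<close> lifts to a set containing a real interval; steering from a sufficiently
  late index finds in that interval a point with the prescribed multiples.\<close>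

lemma dense_tracking_set:
  fixes n :: "nat \<Rightarrow> nat"
  assumes pos: "\<And>k. n k > 0"
    and lim: "filterlim (\<lambda>k. real (n (Suc k)) / real (n k)) at_top sequentially"
    and W: "open W" "W \<noteq> {}"
  shows "W \<inter> tracking_set n c m \<noteq> {}"
proof -
  obtain w a where "w \<in> W" "w = to_circle a" using W surj_to_circle by (metis surjD equals0I)
  moreover have "open (to_circle -` W)" using W by (simp add: open_circle_def)
  ultimately obtain r where r: "r > 0" "cball a r \<subseteq> to_circle -` W"
    by (metis open_contains_cball vimage_eq)
  \<comment> \<open>For \<open>m = 0\<close> tracking is vacuous and \<open>1 / real m\<close> is 0;
    the value 1 keeps \<open>\<delta>\<close> positive, as the steering requires.\<close>
  define \<delta> where "\<delta> = (if m = 0 then 1 else 1 / real m)"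
  have \<delta>: "0 < \<delta>" "\<delta> \<le> 1" by (auto simp: \<delta>_def)
  have "\<forall>\<^sub>F k in sequentially. real (n (Suc k)) / real (n k) \<ge> 4 / \<delta>"
    using lim by (simp add: filterlim_at_top)
  then obtain K where K: "\<And>k. k \<ge> K \<Longrightarrow> real (n (Suc k)) / real (n k) \<ge> 4 / \<delta>"
    by (auto simp: eventually_sequentially)
  have "\<forall>\<^sub>F k in sequentially. real (n k) \<ge> 2 / r"
    using filterlim_lacunary[OF pos lim] by (simp add: filterlim_at_top)
  then have "\<forall>\<^sub>F k in sequentially. real (n k) \<ge> 2 / r \<and> k \<ge> K \<and> k \<ge> m"
    by (intro eventually_conj eventually_ge_at_top)
  then obtain L where L: "real (n L) \<ge> 2 / r" "L \<ge> K" "L \<ge> m"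
    by (metis (no_types, lifting) eventually_happens trivial_limit_sequentially)
  define y where "y k = real_of_rat (c ! (k mod length c))" for k
  have K': "\<forall>k\<ge>L. real (n (Suc k)) / real (n k) \<ge> 4 / \<delta>"
    using K L(2) by simp
  have "r \<ge> 2 / real (n L)" using L(1) r(1) pos[of L] by (simp add: field_simps)
  \<comment> \<open>\<open>L\<close> is fixed first because the end of the tracked range depends on
    it; steering for \<open>m * L * length c\<close> further indices covers that range.\<close>
  from lacunary_steering[of n \<delta> L r "m * L * length c" a y, OF pos \<delta> K' this]
  obtain t where t: "{t..t + \<delta> / (2 * n (L + m * L * length c))} \<subseteq> {a..a + r}"
    "\<forall>s\<in>{t..t + \<delta> / (2 * n (L + m * L * length c))}. \<forall>k\<in>{L..L+m * L * length c}.
        \<exists>z\<in>\<int>. \<bar>n k * s - (y k + z)\<bar> < \<delta>"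
    by (elim exE conjE)
  have "t \<in> {t..t + \<delta> / (2 * n (L + m * L * length c))}" using \<delta> by simp
  with t have ta: "t \<in> {a..a + r}" and near: "\<And>k. k \<in> {L..L+m * L * length c} \<Longrightarrow> \<exists>z\<in>\<int>. \<bar>n k * t - (y k + z)\<bar> < \<delta>"
    by blast+
  have "t \<in> cball a r" using ta by (simp add: dist_real_def)
  then have "to_circle t \<in> W" using r(2) by blast
  moreover have "tracks (\<lambda>k. circle_mult (n k) (to_circle t)) c m L"
    unfolding tracks_def
  proof (intro allI impI)
    fix k assume k: "L \<le> k \<and> k < m * L * length c"
    then have "m \<noteq> 0" by (cases m) auto
    obtain z where z: "z \<in> \<int>" "\<bar>n k * t - (y k + z)\<bar> < \<delta>" using near[of k] k by auto
    have "circle_mult (n k) (to_circle t) = to_circle (n k * t - z)"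
      using z by (simp add: circle_mult_to_circle to_circle_eq_iff)
    moreover have "n k * t - z \<in> ball (y k) (1 / m)"
      using z(2) \<open>m \<noteq> 0\<close> by (simp add: \<delta>_def dist_real_def abs_minus_commute algebra_simps)
    ultimately show "circle_mult (n k) (to_circle t) \<in> to_circle ` ball (of_rat (c ! (k mod length c))) (1 / real m)"
      unfolding y_def by blast
  qed
  ultimately show ?thesis using L(3) by (auto simp: tracking_set_def)
qed

section \<open>Baire category and conclusion\<close>

lemma residual_if_INT_open_dense:
  fixes U :: "'i::countable \<Rightarrow> 'a::topological_space set"
  assumes "\<And>i. open (U i)" "\<And>i W. open W \<Longrightarrow> W \<noteq> {} \<Longrightarrow> W \<inter> U i \<noteq> {}" "(\<Inter>i. U i) \<subseteq> S"
  shows "residual S"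
proof -
  \<comment> \<open>\<open>meager\<close> demands equality with the union, so each closed nowhere
    dense complement is cut down to \<open>- S\<close>.\<close>
  define A where "A j = - U (from_nat j) \<inter> - S" for j
  have "nowhere_dense (A j)" for j
  proof -
    have "closure (A j) \<subseteq> - U (from_nat j)"
      using assms(1) by (intro closure_minimal) (auto simp: A_def)
    then have "interior (closure (A j)) \<inter> U (from_nat j) = {}"
      using interior_subset by blast
    then show ?thesis
      using assms(2) unfolding nowhere_dense_def by (metis open_interior)
  qed
  moreover have "- S = (\<Union>j. A j)"
  proof -
    have "\<exists>j. x \<in> A j" if x: "x \<notin> S" for x
    proof -
      obtain i where "x \<notin> U i" using assms(3) x by blast
      with x have "x \<in> A (to_nat i)" by (simp add: A_def)
      then show ?thesis ..
    qed
    then show ?thesis by (auto simp: A_def)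
  qed
  ultimately show ?thesis
    unfolding residual_def meager_def by blast
qed

theorem theorem2p6:
  fixes n :: "nat \<Rightarrow> nat"
  assumes "\<And>k. n k > 0"
    and "filterlim (\<lambda>k. real (n (Suc k)) / real (n k)) at_top sequentially"
  shows "residual {\<alpha> :: circle. maldistributed (\<lambda>k. circle_mult (n k) \<alpha>)}"
proof (rule residual_if_INT_open_dense)
  \<comment> \<open>The index is a pair of a rational list and a natural number, hence of countable
    type. A point in all these sets tracks every list at every precision.\<close>
  show "open (case_prod (tracking_set n) i)" for i
    by (simp add: split_beta open_tracking_set)
  show "W \<inter> case_prod (tracking_set n) i \<noteq> {}" if "open W" "W \<noteq> {}" for i W
    using dense_tracking_set[OF assms that] by (simp add: split_beta)
  show "(\<Inter>i. case_prod (tracking_set n) i) \<subseteq> {\<alpha>. maldistributed (\<lambda>k. circle_mult (n k) \<alpha>)}"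
    by (auto simp: tracking_set_def intro!: maldistributed_if_tracks)
qed

end
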